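(* Let $X$ be a locally convex Hausdorff space and $T:X\to X$ a continuous, linear operator. Then the following statements are equivalent: (i) $T$ is Cesàro bounded; (ii) $T$ is $M_p$-bounded for some $p>-1$; (iii) $T$ is $M_p$-bounded for all $p>-1$.
   Context: Spaces are over $\mathbb{C}$, and $T^0=\mathrm{Id}$. $T$ is Cesàro bounded if the sequence of Cesàro means $T_{[n]}=\frac1{n+1}\sum_{k=0}^nT^k$, $n\ge0$, is equicontinuous. For $p\in\mathbb{R}$ and $n\ge1$ let $S(n,p)=\sum_{i=1}^n i^p$, and let $M_p$ be the infinite lower triangular matrix (rows and columns indexed from $1$) with entries $i^p/S(n,p)$ for $1\le i\le n$ and $0$ for $i>n$. Column $i$ is applied to $T^{i-1}$, so $(M_pT)_n=\frac1{S(n,p)}\sum_{k=1}^n k^pT^{k-1}$ for $n\ge1$. $T$ is $M_p$-bounded if $\{(M_pT)_n\}_{n\ge1}$ is equicontinuous, i.e. for every continuous seminorm $r$ on $X$ there is a continuous seminorm $q$ on $X$ with $r((M_pT)_nx)\le q(x)$ for all $x\in X$, $n\ge1$. *)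

theory Defs
  imports "HOL-Analysis.Analysis"
begin

text \<open>
  HOL-Analysis has no class of complex topological vector spaces. The additive group and its
  Hausdorff group topology come from type classes; the complex scalar multiplication is a
  locale parameter in the style of \<^locale>\<open>vector_space\<close>.
\<close>

definition convex_wrt :: "(complex \<Rightarrow> 'a::ab_group_add \<Rightarrow> 'a) \<Rightarrow> 'a set \<Rightarrow> bool" where
  "convex_wrt scaleC C \<longleftrightarrow>
     (\<forall>x\<in>C. \<forall>y\<in>C. \<forall>u\<ge>0. \<forall>v\<ge>0. u + v = 1 \<longrightarrow>
        scaleC (complex_of_real u) x + scaleC (complex_of_real v) y \<in> C)"

locale locally_convex_hausdorff = vector_space scaleC
  for scaleC :: "complex \<Rightarrow> 'a::{t2_space, topological_ab_group_add} \<Rightarrow> 'a" +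
  assumes continuous_scale: "continuous_on UNIV (\<lambda>(a, x). scaleC a x)"
    and convex_base_0:
      "\<And>U. open U \<Longrightarrow> 0 \<in> U \<Longrightarrow> \<exists>V. open V \<and> 0 \<in> V \<and> V \<subseteq> U \<and> convex_wrt scaleC V"

definition continuous_seminorm ::
    "(complex \<Rightarrow> 'a::{topological_space, ab_group_add} \<Rightarrow> 'a) \<Rightarrow> ('a \<Rightarrow> real) \<Rightarrow> bool" where
  "continuous_seminorm scaleC r \<longleftrightarrow>
     (\<forall>x y. r (x + y) \<le> r x + r y) \<and>
     (\<forall>a x. r (scaleC a x) = cmod a * r x) \<and>
     continuous_on UNIV r"

definition equicontinuous_family ::
    "(complex \<Rightarrow> 'a::{topological_space, ab_group_add} \<Rightarrow> 'a) \<Rightarrow> 'i set \<Rightarrow> ('i \<Rightarrow> 'a \<Rightarrow> 'a) \<Rightarrow> bool"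
  where
  "equicontinuous_family scaleC I F \<longleftrightarrow>
     (\<forall>r. continuous_seminorm scaleC r \<longrightarrow>
       (\<exists>q. continuous_seminorm scaleC q \<and> (\<forall>x. \<forall>n\<in>I. r (F n x) \<le> q x)))"

definition cesaro_mean ::
    "(complex \<Rightarrow> 'a::ab_group_add \<Rightarrow> 'a) \<Rightarrow> ('a \<Rightarrow> 'a) \<Rightarrow> nat \<Rightarrow> 'a \<Rightarrow> 'a" where
  "cesaro_mean scaleC T n x = scaleC (1 / of_nat (n + 1)) (\<Sum>k=0..n. (T ^^ k) x)"

definition cesaro_bounded ::
    "(complex \<Rightarrow> 'a::{topological_space, ab_group_add} \<Rightarrow> 'a) \<Rightarrow> ('a \<Rightarrow> 'a) \<Rightarrow> bool" where
  "cesaro_bounded scaleC T \<longleftrightarrow> equicontinuous_family scaleC UNIV (cesaro_mean scaleC T)"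

definition power_sum :: "nat \<Rightarrow> real \<Rightarrow> real" where
  "power_sum n p = (\<Sum>i=1..n. real i powr p)"

text \<open>Infinite matrices are functions of the row and column index; both start at 1.\<close>

definition power_matrix :: "real \<Rightarrow> nat \<Rightarrow> nat \<Rightarrow> real" where
  "power_matrix p n i = (if 1 \<le> i \<and> i \<le> n then real i powr p / power_sum n p else 0)"

text \<open>
  The \<open>n\<close>-th row of a lower triangular matrix \<open>A\<close> vanishes beyond column \<open>n\<close>, so the row sum
  is finite. Column \<open>i\<close> multiplies \<open>T ^^ (i - 1)\<close>.
\<close>

definition matrix_mean ::
    "(complex \<Rightarrow> 'a::ab_group_add \<Rightarrow> 'a) \<Rightarrow> (nat \<Rightarrow> nat \<Rightarrow> real) \<Rightarrow> ('a \<Rightarrow> 'a) \<Rightarrow> nat \<Rightarrow> 'a \<Rightarrow> 'a" where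
  "matrix_mean scaleC A T n x = (\<Sum>i=1..n. scaleC (complex_of_real (A n i)) ((T ^^ (i - 1)) x))"

definition M_bounded ::
    "(complex \<Rightarrow> 'a::{topological_space, ab_group_add} \<Rightarrow> 'a) \<Rightarrow> real \<Rightarrow> ('a \<Rightarrow> 'a) \<Rightarrow> bool" where
  "M_bounded scaleC p T \<longleftrightarrow> equicontinuous_family scaleC {1..} (matrix_mean scaleC (power_matrix p) T)"

end

theory Submission
  imports Defs
begin

text \<open>
  Cesaro boundedness is the case \<open>p = 0\<close>, up to an index shift by one; so the whole theorem is that \<open>M\<^sub>p\<close>-boundedness implies \<open>M\<^sub>s\<close>-boundedness for any
  two exponents above \<open>-1\<close> (\<open>M_bounded_change_exponent\<close>).

  Fix an orbit \<open>y\<^sub>i = T\<^sup>i\<^sup>-\<^sup>1 x\<close> and a seminorm \<open>r\<close>, and write \<open>i\<^sup>s = c\<^sub>i i\<^sup>p\<close> with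
  \<open>c\<^sub>i = i\<^sup>s\<^sup>-\<^sup>p\<close>. Summation by parts expresses \<open>\<Sum>\<^sub>i\<^sub>\<le>\<^sub>n i\<^sup>s y\<^sub>i\<close> through the partial sums
  \<open>B\<^sub>k = \<Sum>\<^sub>i\<^sub>\<le>\<^sub>k i\<^sup>p y\<^sub>i\<close>, as \<open>c\<^sub>n B\<^sub>n\<close> plus the sum of the terms \<open>(c\<^sub>k - c\<^sub>k\<^sub>+\<^sub>1) B\<^sub>k\<close> with \<open>k < n\<close>.
  Being \<open>M\<^sub>p\<close>-bounded means \<open>r(B\<^sub>k) \<le> S(k,p) q(x)\<close> with a continuous seminorm \<open>q\<close> that
  depends only on \<open>r\<close>. As \<open>c\<close> is monotone, all the differences have the same sign, so the values
  of \<open>r\<close> at these terms add up to at most \<open>\<bar>S(n,s) - c\<^sub>n S(n,p)\<bar> q(x)\<close>, by the same summation by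
  parts for real numbers (\<open>seminorm_summation_by_parts\<close>).

  It remains to see that \<open>c\<^sub>n S(n,p)\<close> is at most a constant times \<open>S(n,s)\<close>. This is where
  \<open>p > -1\<close> and \<open>s > -1\<close> enter: then \<open>S(n,p)\<close> is of exact order \<open>n\<^sup>p\<^sup>+\<^sup>1\<close>, and likewise for \<open>s\<close>
  (\<open>power_sum_comparison\<close>).
\<close>

section \<open>The order of growth of the power sums\<close>

text \<open>
  The mean value theorem applied to \<open>x\<^sup>p\<^sup>+\<^sup>1\<close>. The interval may start at \<open>0\<close>, where this function
  is continuous but possibly not differentiable.
\<close>

lemma powr_increment_mvt:
  fixes p :: real and n :: nat
  assumes "p > -1"
  obtains z where "real n < z" "z < real (Suc n)"
    "real (Suc n) powr (p + 1) - real n powr (p + 1) = (p + 1) * z powr p"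
proof -
  have "continuous_on {real n..real (Suc n)} (\<lambda>x. x powr (p + 1))"
    using assms by (intro continuous_on_powr' continuous_intros) auto
  moreover have "((\<lambda>x. x powr (p + 1)) has_derivative (\<lambda>h. h * ((p + 1) * z powr p))) (at z)"
    if "real n < z" for z
  proof -
    have "((\<lambda>x. x powr (p + 1)) has_real_derivative (p + 1) * z powr (p + 1 - 1)) (at z)"
      using that by (intro has_real_derivative_powr) auto
    then show ?thesis
      by (simp add: has_field_derivative_def mult.commute[of _ "(p + 1) * z powr p"])
  qed
  ultimately obtain z where "real n < z" "z < real (Suc n)"
    "real (Suc n) powr (p + 1) - real n powr (p + 1)
       = (real (Suc n) - real n) * ((p + 1) * z powr p)"
    using mvt[of "real n" "real (Suc n)" "\<lambda>x. x powr (p + 1)" "\<lambda>z h. h * ((p + 1) * z powr p)"]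
    by auto
  with that show thesis by auto
qed

text \<open>
  For \<open>p \<ge> 0\<close> every term is at most \<open>n\<^sup>p\<close>. For negative \<open>p\<close> the terms are
  compared with the increments of \<open>n\<^sup>p\<^sup>+\<^sup>1\<close>, which telescope.
\<close>

lemma power_sum_upper:
  assumes "p > -1"
  shows "power_sum n p \<le> max 1 (1 / (p + 1)) * real n powr (p + 1)"
proof (cases "p \<ge> 0")
  case True
  have "power_sum n p \<le> (\<Sum>i=1..n. real n powr p)"
    unfolding power_sum_def using True by (intro sum_mono powr_mono2) auto
  also have "\<dots> = 1 * real n powr (p + 1)"
    by (cases "n = 0") (auto simp: powr_add)
  also have "\<dots> \<le> max 1 (1 / (p + 1)) * real n powr (p + 1)"
    by (intro mult_right_mono) auto
  finally show ?thesis .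
next
  case False
  have "(p + 1) * power_sum n p \<le> real n powr (p + 1)"
  proof (induction n)
    case 0
    show ?case by (simp add: power_sum_def)
  next
    case (Suc n)
    obtain z where z: "real n < z" "z < real (Suc n)"
      "real (Suc n) powr (p + 1) - real n powr (p + 1) = (p + 1) * z powr p"
      using powr_increment_mvt[OF assms] by blast
    have "real (Suc n) powr p \<le> z powr p"
      using z False by (intro powr_mono2') auto
    then have "(p + 1) * real (Suc n) powr p \<le> (p + 1) * z powr p"
      using assms by (intro mult_left_mono) auto
    with z Suc show ?case
      by (simp add: power_sum_def distrib_left)
  qed
  then have "power_sum n p \<le> 1 / (p + 1) * real n powr (p + 1)"
    using assms by (simp add: field_simps)
  also have "\<dots> \<le> max 1 (1 / (p + 1)) * real n powr (p + 1)"
    by (intro mult_right_mono) auto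
  finally show ?thesis .
qed

text \<open>The same two comparisons, with the roles of the two signs of \<open>p\<close> exchanged.\<close>

lemma power_sum_lower:
  assumes "p > -1"
  shows "min 1 (1 / (p + 1)) * real n powr (p + 1) \<le> power_sum n p"
proof (cases "p \<ge> 0")
  case True
  have "real n powr (p + 1) \<le> (p + 1) * power_sum n p"
  proof (induction n)
    case 0
    show ?case by (simp add: power_sum_def)
  next
    case (Suc n)
    obtain z where z: "real n < z" "z < real (Suc n)"
      "real (Suc n) powr (p + 1) - real n powr (p + 1) = (p + 1) * z powr p"
      using powr_increment_mvt[OF assms] by blast
    have "z powr p \<le> real (Suc n) powr p"
      using z True by (intro powr_mono2) auto
    then have "(p + 1) * z powr p \<le> (p + 1) * real (Suc n) powr p"
      using assms by (intro mult_left_mono) auto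
    with z Suc show ?case
      by (simp add: power_sum_def distrib_left)
  qed
  then have "1 / (p + 1) * real n powr (p + 1) \<le> power_sum n p"
    using assms by (simp add: field_simps)
  moreover have "min 1 (1 / (p + 1)) * real n powr (p + 1) \<le> 1 / (p + 1) * real n powr (p + 1)"
    by (intro mult_right_mono) auto
  ultimately show ?thesis by linarith
next
  case False
  have "min 1 (1 / (p + 1)) * real n powr (p + 1) \<le> 1 * real n powr (p + 1)"
    by (intro mult_right_mono) auto
  also have "\<dots> = (\<Sum>i=1..n. real n powr p)"
    by (cases "n = 0") (auto simp: powr_add)
  also have "\<dots> \<le> power_sum n p"
    unfolding power_sum_def using False by (intro sum_mono powr_mono2') auto
  finally show ?thesis .
qed

lemma power_sum_pos: "n \<ge> 1 \<Longrightarrow> power_sum n p > 0"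
  unfolding power_sum_def by (intro sum_pos) auto

lemma power_sum_comparison:
  assumes "p > -1" "s > -1"
  obtains K where "K \<ge> 0" "\<And>n. real n powr (s - p) * power_sum n p \<le> K * power_sum n s"
proof
  define C where "C = max 1 (1 / (p + 1))"
  define c where "c = min 1 (1 / (s + 1))"
  have pos: "C > 0" "c > 0"
    using assms by (auto simp: C_def c_def)
  then show "C / c \<ge> 0" by simp
  fix n
  have "real n powr (s - p) * power_sum n p \<le> real n powr (s - p) * (C * real n powr (p + 1))"
    using power_sum_upper[OF assms(1)] by (intro mult_left_mono) (auto simp: C_def)
  also have "\<dots> = C * real n powr (s + 1)"
    by (simp add: powr_add[symmetric])
  also have "\<dots> = C / c * (c * real n powr (s + 1))"
    using pos by simp
  also have "\<dots> \<le> C / c * power_sum n s"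
    using power_sum_lower[OF assms(2)] pos by (intro mult_left_mono) (auto simp: c_def)
  finally show "real n powr (s - p) * power_sum n p \<le> C / c * power_sum n s" .
qed

section \<open>Summation by parts under a seminorm\<close>

text \<open>
  Raising \<open>n\<close> by one changes the vector on the left by \<open>(c\<^sub>n - c\<^sub>n\<^sub>+\<^sub>1) B\<^sub>n\<close>, with \<open>B\<^sub>n\<close> the sum of
  \<open>w\<^sub>i y\<^sub>i\<close>, and the number on the right by the same expression with the sum of the \<open>w\<^sub>i\<close> instead
  of \<open>B\<^sub>n\<close>. The sign \<open>e\<close> records whether \<open>c\<close> decreases or increases; since it is the same at
  every step, the increments on the right, times \<open>e\<close>, are exactly the sums of the \<open>w\<^sub>i\<close> times
  the absolute values of the differences of \<open>c\<close>, which the triangle inequality produces on the left.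
\<close>

lemma seminorm_summation_by_parts:
  fixes scaleC :: "complex \<Rightarrow> 'a::ab_group_add \<Rightarrow> 'a" and r :: "'a \<Rightarrow> real"
    and w c :: "nat \<Rightarrow> real" and y :: "nat \<Rightarrow> 'a"
  assumes vs: "vector_space scaleC"
    and add: "\<And>x z. r (x + z) \<le> r x + r z"
    and hom: "\<And>a x. r (scaleC a x) = cmod a * r x"
    and e: "\<bar>e\<bar> = 1" "\<And>k. 1 \<le> k \<Longrightarrow> 0 \<le> e * (c k - c (Suc k))"
    and partial: "\<And>k. 1 \<le> k \<Longrightarrow> r (\<Sum>i=1..k. scaleC (complex_of_real (w i)) (y i)) \<le> Q * (\<Sum>i=1..k. w i)"
    and n: "1 \<le> n"
  shows "r ((\<Sum>i=1..n. scaleC (complex_of_real (c i * w i)) (y i))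
              - scaleC (complex_of_real (c n)) (\<Sum>i=1..n. scaleC (complex_of_real (w i)) (y i)))
           \<le> Q * (e * ((\<Sum>i=1..n. c i * w i) - c n * (\<Sum>i=1..n. w i)))"
proof -
  interpret vector_space scaleC by (fact vs)
  show ?thesis
    using n
  proof (induction n rule: dec_induct)
    case base
    have "r 0 = 0" using hom[of 0 0] by simp
    then show ?case by simp
  next
    case (step n)
    define B where "B = (\<Sum>i=1..n. scaleC (complex_of_real (w i)) (y i))"
    define W where "W = (\<Sum>i=1..n. w i)"
    define D where "D = (\<Sum>i=1..n. scaleC (complex_of_real (c i * w i)) (y i)) - scaleC (complex_of_real (c n)) B"
    define d where "d = (\<Sum>i=1..n. c i * w i) - c n * W"
    have IH: "r D \<le> Q * (e * d)"
      using step by (simp add: B_def W_def D_def d_def)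
    have abs: "\<bar>c n - c (Suc n)\<bar> = e * (c n - c (Suc n))"
    proof -
      have "\<bar>c n - c (Suc n)\<bar> = \<bar>e * (c n - c (Suc n))\<bar>"
        using e(1) by (simp add: abs_mult)
      also have "\<dots> = e * (c n - c (Suc n))"
        using e(2)[of n] step(1) by simp
      finally show ?thesis .
    qed
    have "(\<Sum>i=1..Suc n. scaleC (complex_of_real (c i * w i)) (y i))
            - scaleC (complex_of_real (c (Suc n))) (\<Sum>i=1..Suc n. scaleC (complex_of_real (w i)) (y i))
          = D + scaleC (complex_of_real (c n - c (Suc n))) B"
      by (simp add: D_def B_def[symmetric] scale_right_distrib scale_left_diff_distrib del: One_nat_def)
    also have "r \<dots> \<le> r D + \<bar>c n - c (Suc n)\<bar> * r B"
      using add[of D "scaleC (complex_of_real (c n - c (Suc n))) B"]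
      by (simp only: hom norm_of_real)
    also have "\<dots> \<le> Q * (e * d) + \<bar>c n - c (Suc n)\<bar> * (Q * W)"
      using IH partial[OF step(1)] by (intro add_mono mult_left_mono) (auto simp: B_def W_def)
    also have "\<dots> = Q * (e * (d + (c n - c (Suc n)) * W))"
      by (simp add: abs algebra_simps)
    also have "d + (c n - c (Suc n)) * W
        = (\<Sum>i=1..Suc n. c i * w i) - c (Suc n) * (\<Sum>i=1..Suc n. w i)"
      by (simp add: d_def W_def algebra_simps)
    finally show ?case .
  qed
qed

section \<open>Independence of the exponent\<close>

lemma matrix_mean_power_matrix:
  assumes "vector_space scaleC"
  shows "matrix_mean scaleC (power_matrix p) T n x
    = scaleC (complex_of_real (1 / power_sum n p))
        (\<Sum>i=1..n. scaleC (complex_of_real (real i powr p)) ((T ^^ (i - 1)) x))"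
proof -
  interpret vector_space scaleC by fact
  show ?thesis
    by (auto simp: matrix_mean_def power_matrix_def scale_sum_right intro!: sum.cong)
qed

lemma continuous_seminorm_nonneg:
  assumes "vector_space scaleC" "continuous_seminorm scaleC r"
  shows "r x \<ge> 0"
proof -
  interpret vector_space scaleC by fact
  have add: "\<And>x y. r (x + y) \<le> r x + r y" and hom: "\<And>a x. r (scaleC a x) = cmod a * r x"
    using assms(2) by (auto simp: continuous_seminorm_def)
  have "r 0 = 0" using hom[of 0 0] by simp
  moreover have "r (- x) = r x" using hom[of "-1" x] by simp
  ultimately show ?thesis using add[of x "- x"] by simp
qed

lemma continuous_seminorm_cmult:
  assumes "continuous_seminorm scaleC q" "K \<ge> 0"
  shows "continuous_seminorm scaleC (\<lambda>x. K * q x)"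
  unfolding continuous_seminorm_def
proof (intro conjI allI)
  show "K * q (x + y) \<le> K * q x + K * q y" for x y
    using assms mult_left_mono[of "q (x + y)" "q x + q y" K]
    by (simp add: continuous_seminorm_def distrib_left)
qed (use assms in \<open>auto simp: continuous_seminorm_def intro!: continuous_intros\<close>)

text \<open>
  With \<open>c\<^sub>n S(n,p) \<le> K S(n,s)\<close>, the boundary term of the summation by parts costs \<open>K S(n,s) q(x)\<close>
  and the remaining sum at most \<open>(K + 1) S(n,s) q(x)\<close>, whence the seminorm \<open>(2 K + 1) q\<close>.
\<close>

lemma M_bounded_change_exponent:
  fixes scaleC :: "complex \<Rightarrow> 'a::{topological_space, ab_group_add} \<Rightarrow> 'a"
  assumes vs: "vector_space scaleC" and ps: "p > -1" "s > -1" and M: "M_bounded scaleC p T"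
  shows "M_bounded scaleC s T"
  unfolding M_bounded_def equicontinuous_family_def
proof (intro allI impI)
  interpret vector_space scaleC by (fact vs)
  fix r assume r: "continuous_seminorm scaleC r"
  have add: "\<And>x z. r (x + z) \<le> r x + r z" and hom: "\<And>a x. r (scaleC a x) = cmod a * r x"
    using r by (auto simp: continuous_seminorm_def)
  obtain q where q: "continuous_seminorm scaleC q"
    and qb: "\<And>x n. n \<ge> 1 \<Longrightarrow> r (matrix_mean scaleC (power_matrix p) T n x) \<le> q x"
    using M r unfolding M_bounded_def equicontinuous_family_def by force
  obtain K where K: "K \<ge> 0" "\<And>n. real n powr (s - p) * power_sum n p \<le> K * power_sum n s"
    using power_sum_comparison[OF ps] by blast
  define c where "c i = real i powr (s - p)" for i
  define e :: real where "e = (if s \<le> p then 1 else -1)"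
  have cw: "c i * real i powr p = real i powr s" for i
    by (simp add: c_def powr_add[symmetric])
  have bound: "r (matrix_mean scaleC (power_matrix s) T n x) \<le> (2 * K + 1) * q x"
    if n: "n \<ge> 1" for n x
  proof -
    define B where "B k = (\<Sum>i=1..k. scaleC (complex_of_real (real i powr p)) ((T ^^ (i - 1)) x))" for k
    define A where "A = (\<Sum>i=1..n. scaleC (complex_of_real (real i powr s)) ((T ^^ (i - 1)) x))"
    have q0: "q x \<ge> 0" using continuous_seminorm_nonneg[OF vs q] .
    have Sn: "power_sum n s > 0" using power_sum_pos[OF n] .
    have rB: "r (B k) \<le> q x * power_sum k p" if k: "k \<ge> 1" for k
      using qb[OF k, of x] power_sum_pos[OF k, of p]
      by (simp add: matrix_mean_power_matrix[OF vs] hom norm_divide B_def field_simps)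
    have cnB: "c n * r (B n) \<le> K * power_sum n s * q x"
    proof -
      have "c n * r (B n) \<le> c n * (q x * power_sum n p)"
        using rB[OF n] by (intro mult_left_mono) (auto simp: c_def)
      also have "\<dots> = (c n * power_sum n p) * q x" by simp
      also have "\<dots> \<le> (K * power_sum n s) * q x"
        using K(2)[of n] q0 by (intro mult_right_mono) (auto simp: c_def)
      finally show ?thesis .
    qed
    have "r (A - scaleC (complex_of_real (c n)) (B n))
        \<le> q x * (e * (power_sum n s - c n * power_sum n p))"
    proof -
      have sgn: "0 \<le> e * (c k - c (Suc k))" if "1 \<le> k" for k
        using that by (auto simp: e_def c_def intro: powr_mono2 powr_mono2')
      have "r ((\<Sum>i=1..n. scaleC (complex_of_real (c i * real i powr p)) ((T ^^ (i - 1)) x))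
              - scaleC (complex_of_real (c n)) (B n))
          \<le> q x * (e * ((\<Sum>i=1..n. c i * real i powr p) - c n * (\<Sum>i=1..n. real i powr p)))"
        unfolding B_def
        by (rule seminorm_summation_by_parts[where r = r and scaleC = scaleC and c = c
              and w = "\<lambda>i. real i powr p" and y = "\<lambda>i. (T ^^ (i - 1)) x", OF vs])
          (use add hom sgn n rB in \<open>auto simp: B_def power_sum_def e_def\<close>)
      then show ?thesis
        by (simp only: cw A_def power_sum_def)
    qed
    also have "\<dots> \<le> q x * ((K + 1) * power_sum n s)"
    proof -
      have "0 \<le> c n * power_sum n p" "c n * power_sum n p \<le> K * power_sum n s"
        "0 \<le> K * power_sum n s"
        using K(1) K(2)[of n] Sn power_sum_pos[OF n, of p] by (auto simp: c_def)
      then have "e * (power_sum n s - c n * power_sum n p) \<le> (K + 1) * power_sum n s"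
        using Sn by (auto simp: e_def distrib_right)
      then show ?thesis using q0 by (intro mult_left_mono)
    qed
    finally have D: "r (A - scaleC (complex_of_real (c n)) (B n)) \<le> q x * ((K + 1) * power_sum n s)" .
    have "r A \<le> r (A - scaleC (complex_of_real (c n)) (B n)) + c n * r (B n)"
      using add[of "A - scaleC (complex_of_real (c n)) (B n)" "scaleC (complex_of_real (c n)) (B n)"]
      by (simp add: hom c_def)
    then have "r A \<le> (2 * K + 1) * q x * power_sum n s"
      using D cnB by (simp add: algebra_simps)
    then show ?thesis
      using Sn by (simp add: matrix_mean_power_matrix[OF vs] hom norm_divide A_def field_simps)
  qed
  show "\<exists>q. continuous_seminorm scaleC q \<and>
          (\<forall>x. \<forall>n\<in>{1..}. r (matrix_mean scaleC (power_matrix s) T n x) \<le> q x)"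
    using continuous_seminorm_cmult[OF q, of "2 * K + 1"] K(1) bound by auto
qed

lemma cesaro_mean_eq_matrix_mean:
  assumes "vector_space scaleC"
  shows "cesaro_mean scaleC T n x = matrix_mean scaleC (power_matrix 0) T (Suc n) x"
proof -
  interpret vector_space scaleC by fact
  have "(\<Sum>k=0..n. (T ^^ k) x) = (\<Sum>i=1..Suc n. (T ^^ (i - 1)) x)"
    by (rule sum.reindex_bij_witness[of _ "\<lambda>i. i - 1" Suc]) auto
  also have "\<dots> = (\<Sum>i=1..Suc n. scaleC (complex_of_real (real i powr 0)) ((T ^^ (i - 1)) x))"
    by (intro sum.cong) auto
  finally have *: "(\<Sum>k=0..n. (T ^^ k) x) = \<dots>" .
  have "power_sum (Suc n) 0 = real (Suc n)"
    by (simp add: power_sum_def)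
  then show ?thesis
    by (simp only: matrix_mean_power_matrix[OF assms] cesaro_mean_def *) simp
qed

lemma cesaro_bounded_iff_M_bounded_0:
  assumes "vector_space scaleC"
  shows "cesaro_bounded scaleC T \<longleftrightarrow> M_bounded scaleC 0 T"
proof -
  have "{1..} = range Suc"
    by (auto simp: image_iff Suc_le_eq gr0_conv_Suc)
  then show ?thesis
    by (simp only: cesaro_bounded_def M_bounded_def equicontinuous_family_def
        cesaro_mean_eq_matrix_mean[OF assms] ball_simps)
qed

theorem theorem5p8:
  fixes scaleC :: "complex \<Rightarrow> 'a::{t2_space, topological_ab_group_add} \<Rightarrow> 'a"
    and T :: "'a \<Rightarrow> 'a"
  assumes "locally_convex_hausdorff scaleC"
    and "Vector_Spaces.linear scaleC scaleC T"
    and "continuous_on UNIV T"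
  shows "(cesaro_bounded scaleC T \<longleftrightarrow> (\<exists>p>-1. M_bounded scaleC p T)) \<and>
         ((\<exists>p>-1. M_bounded scaleC p T) \<longleftrightarrow> (\<forall>p>-1. M_bounded scaleC p T))"
proof -
  have vs: "vector_space scaleC"
    using assms(1) by (simp add: locally_convex_hausdorff_def)
  have "(0::real) > -1" by simp
  then show ?thesis
    using cesaro_bounded_iff_M_bounded_0[OF vs] M_bounded_change_exponent[OF vs] by blast
qed

end
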